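(* Every stringent skew hyperfield $F$, regarded as a skew tract, satisfies the Pathetic Cancellation Property. That is: for all $a,b,x,y,z\in F^\times$ such that $$x\in 1\boxplus a,\quad y\in -1\boxplus b,\quad z\in a\boxplus b,\quad z\in x\boxplus y,$$ $$ax=xa,\quad by=yb,\quad a^{-1}zb^{-1}=b^{-1}za^{-1},\quad x^{-1}zy^{-1}=y^{-1}zx^{-1},$$ one has $z\in xb\boxplus -ay$.
   Context: A hyperoperation $\boxplus$ on a set $S$ assigns to each pair of elements a non-empty subset of $S$. For non-empty $A,B\subseteq S$ put $A\boxplus B=\bigcup_{a\in A,b\in B}a\boxplus b$. A (commutative) hypergroup $(G,\boxplus,0)$ has a commutative, associative hyperoperation such that $0\boxplus x=\{x\}$; for each $x$ there is a unique element $-x$ with $0\in x\boxplus -x$; and $x\in y\boxplus z$ iff $z\in x\boxplus -y$. A skew hyperfield is a tuple $(F,\cdot,\boxplus,1,0)$ with $0\ne1$ such that $(F\setminus\{0\},\cdot,1)$ is a (not necessarily abelian) group, $(F,\boxplus,0)$ is a hypergroup, $x\cdot0=0\cdot x=0$ for all $x$, and $a(x\boxplus y)=ax\boxplus ay$, $(x\boxplus y)a=xa\boxplus ya$ for all $a,x,y\in F$. $F^\times=F\setminus\{0\}$. $F$ is stringent if $a\boxplus b$ is a singleton whenever $a,b\in F$ and $a\neq -b$. The skew tract associated with $F$ is the group $G=F^\times$ together with $N_G=\{\sum_{i=1}^k g_i\in\mathbb N[G]: 0\in g_1\boxplus\cdots\boxplus g_k\}$ (including the zero element). A skew tract $T=(G,N_G)$,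 with $T^\times=G$, $-1$ the unique element of $G$ with $1+(-1)\in N_G$, and $-x=(-1)x$, satisfies Pathetic Cancellation if for all $a,b,x,y,z\in T^\times$ with $1+a-x$, $-1+b-y$, $a+b-z$, $x+y-z\in N_G$, $ax=xa$, $by=yb$, $a^{-1}zb^{-1}=b^{-1}za^{-1}$ and $x^{-1}zy^{-1}=y^{-1}zx^{-1}$, one has $xb-ay-z\in N_G$. *)

theory Defs
  imports "HOL-Algebra.Group" "HOL-Library.Multiset"
begin

section \<open>Hypergroups\<close>

definition set_hadd :: "('a \<Rightarrow> 'a \<Rightarrow> 'a set) \<Rightarrow> 'a set \<Rightarrow> 'a set \<Rightarrow> 'a set" where
  "set_hadd h A B = (\<Union>a\<in>A. \<Union>b\<in>B. h a b)"

definition hyperneg :: "'a set \<Rightarrow> ('a \<Rightarrow> 'a \<Rightarrow> 'a set) \<Rightarrow> 'a \<Rightarrow> 'a \<Rightarrow> 'a" where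
  "hyperneg S h e x = (THE y. y \<in> S \<and> e \<in> h x y)"

locale hypergroup =
  fixes S :: "'a set" and h :: "'a \<Rightarrow> 'a \<Rightarrow> 'a set" and e :: 'a
  assumes zero_closed: "e \<in> S"
    and hadd_nonempty: "\<lbrakk>x \<in> S; y \<in> S\<rbrakk> \<Longrightarrow> h x y \<noteq> {}"
    and hadd_closed: "\<lbrakk>x \<in> S; y \<in> S\<rbrakk> \<Longrightarrow> h x y \<subseteq> S"
    and hadd_comm: "\<lbrakk>x \<in> S; y \<in> S\<rbrakk> \<Longrightarrow> h x y = h y x"
    and hadd_assoc: "\<lbrakk>x \<in> S; y \<in> S; z \<in> S\<rbrakk>
          \<Longrightarrow> set_hadd h (h x y) {z} = set_hadd h {x} (h y z)"
    and hadd_zero: "x \<in> S \<Longrightarrow> h e x = {x}"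
    and neg_ex1: "x \<in> S \<Longrightarrow> \<exists>!y. y \<in> S \<and> e \<in> h x y"
    and reversible: "\<lbrakk>x \<in> S; y \<in> S; z \<in> S\<rbrakk>
          \<Longrightarrow> x \<in> h y z \<longleftrightarrow> z \<in> h x (hyperneg S h e y)"

section \<open>Skew hyperfields\<close>

record 'a hyperring = "'a monoid" +
  hzero :: 'a
  hadd :: "'a \<Rightarrow> 'a \<Rightarrow> 'a set" (infixl "\<boxplus>\<index>" 65)

definition hminus :: "('a, 'm) hyperring_scheme \<Rightarrow> 'a \<Rightarrow> 'a" ("\<boxminus>\<index> _" [81] 80) where
  "hminus F x = hyperneg (carrier F) (hadd F) (hzero F) x"

definition mult_group :: "('a, 'm) hyperring_scheme \<Rightarrow> 'a monoid" where
  "mult_group F = \<lparr>carrier = carrier F - {hzero F}, monoid.mult = monoid.mult F, one = one F\<rparr>"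

locale skew_hyperfield =
  fixes F :: "('a, 'm) hyperring_scheme" (structure)
  assumes one_closed: "\<one> \<in> carrier F"
    and zero_not_one: "hzero F \<noteq> \<one>"
    and mult_group: "group (mult_group F)"
    and hypergroup: "hypergroup (carrier F) (hadd F) (hzero F)"
    and mult_zero: "x \<in> carrier F \<Longrightarrow> x \<otimes> hzero F = hzero F"
    and zero_mult: "x \<in> carrier F \<Longrightarrow> hzero F \<otimes> x = hzero F"
    and distrib_left: "\<lbrakk>a \<in> carrier F; x \<in> carrier F; y \<in> carrier F\<rbrakk>
          \<Longrightarrow> (\<lambda>u. a \<otimes> u) ` (x \<boxplus> y) = (a \<otimes> x) \<boxplus> (a \<otimes> y)"
    and distrib_right: "\<lbrakk>a \<in> carrier F; x \<in> carrier F; y \<in> carrier F\<rbrakk>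
          \<Longrightarrow> (\<lambda>u. u \<otimes> a) ` (x \<boxplus> y) = (x \<otimes> a) \<boxplus> (y \<otimes> a)"

locale stringent_skew_hyperfield = skew_hyperfield +
  assumes stringent: "\<lbrakk>a \<in> carrier F; b \<in> carrier F; a \<noteq> \<boxminus> b\<rbrakk> \<Longrightarrow> is_singleton (a \<boxplus> b)"

section \<open>Skew tracts\<close>

text \<open>The group semiring \<open>\<nat>[G]\<close> is represented by finite multisets over \<open>carrier G\<close>: the
  multiplicity of \<open>g\<close> is its coefficient, and the empty multiset is the zero element.\<close>

record 'a tract = "'a monoid" +
  nullset :: "'a multiset set"

locale skew_tract =
  fixes T :: "('a, 'm) tract_scheme" (structure)
  assumes group: "group T"
    and nullset_over: "s \<in> nullset T \<Longrightarrow> set_mset s \<subseteq> carrier T"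
    and zero_null: "{#} \<in> nullset T"
    and one_not_null: "{#\<one>#} \<notin> nullset T"
    and neg_one_ex1: "\<exists>!u. u \<in> carrier T \<and> {#\<one>, u#} \<in> nullset T"
    and null_mult_left: "\<lbrakk>g \<in> carrier T; s \<in> nullset T\<rbrakk>
          \<Longrightarrow> image_mset (\<lambda>u. g \<otimes> u) s \<in> nullset T"
    and null_mult_right: "\<lbrakk>g \<in> carrier T; s \<in> nullset T\<rbrakk>
          \<Longrightarrow> image_mset (\<lambda>u. u \<otimes> g) s \<in> nullset T"

definition tract_neg_one :: "('a, 'm) tract_scheme \<Rightarrow> 'a" where
  "tract_neg_one T = (THE u. u \<in> carrier T \<and> {#\<one>\<^bsub>T\<^esub>, u#} \<in> nullset T)"

definition tract_neg :: "('a, 'm) tract_scheme \<Rightarrow> 'a \<Rightarrow> 'a" where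
  "tract_neg T x = tract_neg_one T \<otimes>\<^bsub>T\<^esub> x"

definition pathetic_cancellation :: "('a, 'm) tract_scheme \<Rightarrow> bool" where
  "pathetic_cancellation T \<longleftrightarrow>
    (\<forall>a\<in>carrier T. \<forall>b\<in>carrier T. \<forall>x\<in>carrier T. \<forall>y\<in>carrier T. \<forall>z\<in>carrier T.
      {#\<one>\<^bsub>T\<^esub>, a, tract_neg T x#} \<in> nullset T \<longrightarrow>
      {#tract_neg_one T, b, tract_neg T y#} \<in> nullset T \<longrightarrow>
      {#a, b, tract_neg T z#} \<in> nullset T \<longrightarrow>
      {#x, y, tract_neg T z#} \<in> nullset T \<longrightarrow>
      a \<otimes>\<^bsub>T\<^esub> x = x \<otimes>\<^bsub>T\<^esub> a \<longrightarrow>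
      b \<otimes>\<^bsub>T\<^esub> y = y \<otimes>\<^bsub>T\<^esub> b \<longrightarrow>
      inv\<^bsub>T\<^esub> a \<otimes>\<^bsub>T\<^esub> z \<otimes>\<^bsub>T\<^esub> inv\<^bsub>T\<^esub> b = inv\<^bsub>T\<^esub> b \<otimes>\<^bsub>T\<^esub> z \<otimes>\<^bsub>T\<^esub> inv\<^bsub>T\<^esub> a \<longrightarrow>
      inv\<^bsub>T\<^esub> x \<otimes>\<^bsub>T\<^esub> z \<otimes>\<^bsub>T\<^esub> inv\<^bsub>T\<^esub> y = inv\<^bsub>T\<^esub> y \<otimes>\<^bsub>T\<^esub> z \<otimes>\<^bsub>T\<^esub> inv\<^bsub>T\<^esub> x \<longrightarrow>
      {#x \<otimes>\<^bsub>T\<^esub> b, tract_neg T (a \<otimes>\<^bsub>T\<^esub> y), tract_neg T z#} \<in> nullset T)"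

section \<open>The skew tract of a skew hyperfield\<close>

text \<open>\<open>g\<^sub>1 \<boxplus> \<dots> \<boxplus> g\<^sub>k\<close>, bracketed to the right; the trailing zero is neutral and gives
  the empty hypersum the value \<open>{0}\<close>.\<close>

definition hsum :: "('a, 'm) hyperring_scheme \<Rightarrow> 'a list \<Rightarrow> 'a set" where
  "hsum F gs = foldr (\<lambda>g A. set_hadd (hadd F) {g} A) gs {hzero F}"

definition tract_of :: "('a, 'm) hyperring_scheme \<Rightarrow> 'a tract" where
  "tract_of F = monoid.extend (mult_group F)
     \<lparr>nullset = {mset gs | gs. set gs \<subseteq> carrier (mult_group F) \<and> hzero F \<in> hsum F gs}\<rparr>"

context skew_hyperfield
begin

interpretation H: hypergroup "carrier F" "hadd F" "hzero F" by (rule hypergroup)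
interpretation G: group "mult_group F" by (rule mult_group)

lemma mult_group_simps [simp]:
  "carrier (mult_group F) = carrier F - {hzero F}"
  "monoid.mult (mult_group F) = monoid.mult F" "one (mult_group F) = \<one>"
  by (simp_all add: mult_group_def)

lemma tract_of_simps [simp]:
  "carrier (tract_of F) = carrier F - {hzero F}"
  "monoid.mult (tract_of F) = monoid.mult F" "one (tract_of F) = \<one>"
  "nullset (tract_of F) =
     {mset gs | gs. set gs \<subseteq> carrier F - {hzero F} \<and> hzero F \<in> hsum F gs}"
  by (simp_all add: tract_of_def monoid.extend_def)

lemma hsum_simps [simp]: "hsum F [] = {hzero F}"
  "hsum F (g # gs) = (\<Union>u\<in>hsum F gs. g \<boxplus> u)"
  by (simp_all add: hsum_def set_hadd_def)

lemma hadd_zero_right: "x \<in> carrier F \<Longrightarrow> x \<boxplus> hzero F = {x}"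
  using H.hadd_comm H.hadd_zero H.zero_closed by metis

lemma hsum_closed: "set gs \<subseteq> carrier F \<Longrightarrow> hsum F gs \<subseteq> carrier F"
proof (induction gs)
  case Nil then show ?case by (simp add: H.zero_closed)
next
  case (Cons g gs) then show ?case using H.hadd_closed by fastforce
qed

lemma mult_closed: "\<lbrakk>x \<in> carrier F; y \<in> carrier F\<rbrakk> \<Longrightarrow> x \<otimes> y \<in> carrier F"
  using G.m_closed[of x y] mult_zero zero_mult H.zero_closed
  by (cases "x = hzero F"; cases "y = hzero F") auto

lemma hsum_mult_left:
  assumes "a \<in> carrier F" "set gs \<subseteq> carrier F"
  shows "hsum F (map (\<lambda>u. a \<otimes> u) gs) = (\<lambda>u. a \<otimes> u) ` hsum F gs"
  using assms(2)
proof (induction gs)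
  case Nil then show ?case using assms(1) by (simp add: mult_zero)
next
  case (Cons g gs)
  then have "hsum F gs \<subseteq> carrier F" using hsum_closed by simp
  then have "(a \<otimes> g) \<boxplus> (a \<otimes> u) = (\<lambda>u. a \<otimes> u) ` (g \<boxplus> u)" if "u \<in> hsum F gs" for u
    using that Cons.prems assms(1) distrib_left[of a g u] by auto
  then show ?case using Cons by (simp add: image_UN)
qed

lemma hsum_mult_right:
  assumes "a \<in> carrier F" "set gs \<subseteq> carrier F"
  shows "hsum F (map (\<lambda>u. u \<otimes> a) gs) = (\<lambda>u. u \<otimes> a) ` hsum F gs"
  using assms(2)
proof (induction gs)
  case Nil then show ?case using assms(1) by (simp add: zero_mult)
next
  case (Cons g gs)
  then have "hsum F gs \<subseteq> carrier F" using hsum_closed by simp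
  then have "(g \<otimes> a) \<boxplus> (u \<otimes> a) = (\<lambda>u. u \<otimes> a) ` (g \<boxplus> u)" if "u \<in> hsum F gs" for u
    using that Cons.prems assms(1) distrib_right[of a g u] by auto
  then show ?case using Cons by (simp add: image_UN)
qed

lemma pair_null_iff:
  assumes "x \<in> carrier F - {hzero F}" "y \<in> carrier F - {hzero F}"
  shows "{#x, y#} \<in> nullset (tract_of F) \<longleftrightarrow> hzero F \<in> x \<boxplus> y"
proof -
  have sum: "hsum F [u, v] = u \<boxplus> v" if "v \<in> carrier F" for u v
    using that by (simp add: hadd_zero_right)
  have "gs = [x, y] \<or> gs = [y, x]" if gs: "{#x, y#} = mset gs" for gs
  proof -
    have "length gs = 2"
      using arg_cong[OF gs, of size] by simp
    then obtain u v where "gs = [u, v]"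
      by (auto simp: numeral_2_eq_2 length_Suc_conv)
    then show ?thesis using gs by (auto simp: add_eq_conv_ex)
  qed
  moreover have "hsum F [x, y] = x \<boxplus> y" "hsum F [y, x] = x \<boxplus> y"
    using sum assms H.hadd_comm by (metis DiffD1)+
  moreover have "{#x, y#} = mset [x, y]" "set [x, y] \<subseteq> carrier F - {hzero F}"
    using assms by auto
  ultimately show ?thesis
    unfolding tract_of_simps(4) mem_Collect_eq by metis
qed

theorem skew_tract_tract_of: "skew_tract (tract_of F)"
proof
  show "x \<otimes>\<^bsub>tract_of F\<^esub> y \<in> carrier (tract_of F)"
    if "x \<in> carrier (tract_of F)" "y \<in> carrier (tract_of F)" for x y
    using that G.m_closed[of x y] by simp
  show "x \<otimes>\<^bsub>tract_of F\<^esub> y \<otimes>\<^bsub>tract_of F\<^esub> z = x \<otimes>\<^bsub>tract_of F\<^esub> (y \<otimes>\<^bsub>tract_of F\<^esub> z)"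
    if "x \<in> carrier (tract_of F)" "y \<in> carrier (tract_of F)" "z \<in> carrier (tract_of F)" for x y z
    using that G.m_assoc[of x y z] by simp
  show "\<one>\<^bsub>tract_of F\<^esub> \<in> carrier (tract_of F)"
    using one_closed zero_not_one by simp
  show "\<one>\<^bsub>tract_of F\<^esub> \<otimes>\<^bsub>tract_of F\<^esub> x = x" "x \<otimes>\<^bsub>tract_of F\<^esub> \<one>\<^bsub>tract_of F\<^esub> = x"
    if "x \<in> carrier (tract_of F)" for x
    using that G.l_one[of x] G.r_one[of x] by simp_all
  show "carrier (tract_of F) \<subseteq> Units (tract_of F)"
    using G.Units_eq by (auto simp: Units_def)
  show "set_mset s \<subseteq> carrier (tract_of F)" if "s \<in> nullset (tract_of F)" for s
    using that by auto
  show "{#} \<in> nullset (tract_of F)"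
    by (auto intro!: exI[of _ "[]"])
  show "{#\<one>\<^bsub>tract_of F\<^esub>#} \<notin> nullset (tract_of F)"
    using one_closed zero_not_one by (auto simp: hadd_zero_right dest!: mset_single_iff[THEN iffD1, OF sym])
  show "\<exists>!u. u \<in> carrier (tract_of F) \<and> {#\<one>\<^bsub>tract_of F\<^esub>, u#} \<in> nullset (tract_of F)"
  proof -
    have one: "\<one> \<in> carrier F - {hzero F}" using one_closed zero_not_one by simp
    have "hzero F \<notin> \<one> \<boxplus> hzero F"
      using one_closed zero_not_one by (simp add: hadd_zero_right)
    then have "(u \<in> carrier F - {hzero F} \<and> {#\<one>, u#} \<in> nullset (tract_of F))
        \<longleftrightarrow> (u \<in> carrier F \<and> hzero F \<in> \<one> \<boxplus> u)" for u
      using pair_null_iff[OF one, of u] by (cases "u = hzero F") auto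
    then show ?thesis using H.neg_ex1[OF one_closed] by (simp del: tract_of_simps(4))
  qed
  fix g s assume g: "g \<in> carrier (tract_of F)" and "s \<in> nullset (tract_of F)"
  then obtain gs where gs: "s = mset gs" "set gs \<subseteq> carrier F - {hzero F}" "hzero F \<in> hsum F gs"
    by auto
  have gc: "g \<in> carrier F" "set gs \<subseteq> carrier F" using g gs by auto
  have "set (map (\<lambda>u. g \<otimes> u) gs) \<subseteq> carrier F - {hzero F}"
       "set (map (\<lambda>u. u \<otimes> g) gs) \<subseteq> carrier F - {hzero F}"
    using G.m_closed g gs(2) by (auto simp: subset_iff)
  moreover have "hzero F \<in> hsum F (map (\<lambda>u. g \<otimes> u) gs)" "hzero F \<in> hsum F (map (\<lambda>u. u \<otimes> g) gs)"
    using gs(3) mult_zero[OF gc(1)] zero_mult[OF gc(1)]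
    by (auto simp: hsum_mult_left[OF gc] hsum_mult_right[OF gc] image_iff intro!: bexI[of _ "hzero F"])
  ultimately show "image_mset (\<lambda>u. g \<otimes>\<^bsub>tract_of F\<^esub> u) s \<in> nullset (tract_of F)"
      "image_mset (\<lambda>u. u \<otimes>\<^bsub>tract_of F\<^esub> g) s \<in> nullset (tract_of F)"
    unfolding tract_of_simps gs(1) by (metis (mono_tags, lifting) mem_Collect_eq mset_map)+
qed

end

end

theory Submission
  imports Defs
begin

text \<open>Formally \<open>x = 1 + a\<close>, \<open>y = -1 + b\<close> and \<open>z = a + b\<close> give
  \<open>xb - ay = (1 + a)b - a(-1 + b) = b + ab + a - ab = z\<close>. In a hyperfield the cancellation of
  \<open>ab\<close> leaves an error from \<open>ab \<boxplus> -ab\<close>, and the point is to show that this error is harmless.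

  Call \<open>t \<boxplus> -t\<close> the ball of \<open>t\<close>. In a stringent hypergroup the balls behave like those of an
  ultrametric: an element outside a ball absorbs every element of it
  (\<open>outside_ball_absorbs\<close>), balls are closed under addition (\<open>ball_hadd_closed\<close>), and two elements
  that lie in each other's balls agree up to sign (\<open>ball_antisym\<close>). Consequently an error from the
  ball of \<open>t\<close> can matter to a difference \<open>p \<boxplus> -q\<close> only if \<open>p\<close> and \<open>q\<close> both lie in that ball
  (\<open>terms_in_ball_of_error\<close>).

  The same formal computation works with \<open>xy\<close> instead of \<open>ab\<close>, starting from \<open>z = x + y\<close>. If the
  conclusion fails, then \<open>xb\<close> and \<open>ay\<close> lie in the balls of both \<open>ab\<close> and \<open>xy\<close>. Balls are compatible with
  multiplication, so common factors cancel, and antisymmetry gives \<open>x = \<plusminus>a\<close> and \<open>y = \<plusminus>b\<close>. These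
  few cases are contradictory (\<open>sum_mem_cross_difference\<close>).

  The statement about tracts is the same one, because a null sum of three terms
  \<open>u + v - w\<close> expresses \<open>w \<in> u \<boxplus> v\<close> (\<open>triple_null_iff\<close>).\<close>

section \<open>Negation in a hypergroup\<close>

context hypergroup
begin

abbreviation neg :: "'a \<Rightarrow> 'a" where
  "neg x \<equiv> hyperneg S h e x"

lemma neg_closed: "x \<in> S \<Longrightarrow> neg x \<in> S"
  and zero_in_hadd_neg: "x \<in> S \<Longrightarrow> e \<in> h x (neg x)"
  using theI'[OF neg_ex1, of x] by (simp_all add: hyperneg_def)

lemma neg_unique: "\<lbrakk>x \<in> S; y \<in> S; e \<in> h x y\<rbrakk> \<Longrightarrow> y = neg x"
  using neg_ex1[of x] neg_closed[of x] zero_in_hadd_neg[of x] by blast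

lemma neg_neg: "x \<in> S \<Longrightarrow> neg (neg x) = x"
  using neg_unique[of "neg x" x] hadd_comm[of x "neg x"] neg_closed zero_in_hadd_neg by metis

lemma mem_hadd_closed: "\<lbrakk>z \<in> h x y; x \<in> S; y \<in> S\<rbrakk> \<Longrightarrow> z \<in> S"
  using hadd_closed by blast

lemma move_left: "\<lbrakk>z \<in> h x y; x \<in> S; y \<in> S\<rbrakk> \<Longrightarrow> y \<in> h z (neg x)"
  using reversible[of z x y] mem_hadd_closed by blast

lemma move_right: "\<lbrakk>z \<in> h x y; x \<in> S; y \<in> S\<rbrakk> \<Longrightarrow> x \<in> h z (neg y)"
  using move_left[of z y x] hadd_comm[of x y] by blast

lemma neg_hadd:
  assumes "z \<in> h x y" "x \<in> S" "y \<in> S"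
  shows "neg z \<in> h (neg x) (neg y)"
proof -
  have z: "z \<in> S" using assms mem_hadd_closed by blast
  have "neg x \<in> h y (neg z)"
    using move_left[OF move_left[OF assms]] z assms neg_closed by blast
  then show ?thesis
    using move_left[of "neg x" y "neg z"] assms z neg_closed by blast
qed

lemma hadd_assocE:
  assumes "z \<in> h u v" "v \<in> h s t" "u \<in> S" "s \<in> S" "t \<in> S"
  obtains r where "r \<in> h u s" "z \<in> h r t"
  using hadd_assoc[of u s t] assms unfolding set_hadd_def by blast

lemma hadd_assocE':
  assumes "z \<in> h v t" "v \<in> h u s" "u \<in> S" "s \<in> S" "t \<in> S"
  obtains r where "r \<in> h s t" "z \<in> h u r"
  using hadd_assoc[of u s t] assms unfolding set_hadd_def by blast

text \<open>The hypersum of an element with its negative is the error that the formal cancellation of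
  two summands leaves behind. In the examples with a valuation it consists of the elements
  that are small compared with the given one, whence the name.\<close>

abbreviation ball :: "'a \<Rightarrow> 'a set" where
  "ball t \<equiv> h t (neg t)"

lemma ball_closed: "t \<in> S \<Longrightarrow> ball t \<subseteq> S"
  using hadd_closed neg_closed by blast

lemma ball_neg: "t \<in> S \<Longrightarrow> ball (neg t) = ball t"
  using hadd_comm neg_closed neg_neg by metis

lemma neg_mem_ball: "\<lbrakk>s \<in> ball t; t \<in> S\<rbrakk> \<Longrightarrow> neg s \<in> ball t"
  using neg_hadd[of s t "neg t"] ball_neg neg_closed by metis

lemma neg_mem_ball_iff: "\<lbrakk>s \<in> S; t \<in> S\<rbrakk> \<Longrightarrow> neg s \<in> ball t \<longleftrightarrow> s \<in> ball t"
  using neg_mem_ball neg_neg by metis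

text \<open>Lying in the ball of \<open>t\<close> means being absorbed by \<open>t\<close>, by reversibility.\<close>

lemma mem_ball_iff: "\<lbrakk>s \<in> S; t \<in> S\<rbrakk> \<Longrightarrow> s \<in> ball t \<longleftrightarrow> t \<in> h t s"
  using reversible[of t t s] by blast

text \<open>Replacing each summand of \<open>z\<close> by a difference with a common term \<open>t\<close> introduces an
  error in the ball of \<open>t\<close> only.\<close>

lemma sum_of_differences:
  assumes z: "z \<in> h c d" and c: "c \<in> h (neg q) t" and d: "d \<in> h p (neg t)"
    and S: "p \<in> S" "q \<in> S" "t \<in> S"
  obtains w s where "w \<in> h p (neg q)" "s \<in> ball t" "z \<in> h w s"
proof -
  note S' = S neg_closed[OF S(1)] neg_closed[OF S(2)] neg_closed[OF S(3)]
  have dS: "d \<in> S" using d S' mem_hadd_closed by blast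
  obtain r where r: "r \<in> h t d" "z \<in> h (neg q) r"
    using hadd_assocE'[OF z c] S' dS by blast
  have rS: "r \<in> S" using r S' dS mem_hadd_closed by blast
  have "r \<in> h d t" "d \<in> h p (neg t)" using r d hadd_comm S' dS by auto
  then obtain s where s: "s \<in> h (neg t) t" "r \<in> h p s"
    using hadd_assocE' S' by blast
  have sb: "s \<in> ball t" and sS: "s \<in> S"
    using s hadd_comm S' mem_hadd_closed by auto
  obtain w where "w \<in> h (neg q) p" "z \<in> h w s"
    using hadd_assocE[OF r(2) s(2)] S' sS by blast
  then show thesis using that sb hadd_comm S' by blast
qed

end

section \<open>Balls in a stringent hypergroup\<close>

locale stringent_hypergroup = hypergroup +
  assumes stringent: "\<lbrakk>a \<in> S; b \<in> S; a \<noteq> neg b\<rbrakk> \<Longrightarrow> is_singleton (h a b)"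
begin

lemma hadd_eq_singleton: "\<lbrakk>z \<in> h a b; a \<in> S; b \<in> S; a \<noteq> neg b\<rbrakk> \<Longrightarrow> h a b = {z}"
  using stringent[of a b] by (auto simp: is_singleton_def)

text \<open>An element outside a ball absorbs the whole ball. If \<open>s \<noteq> -t\<close>, then \<open>s \<boxplus> t\<close> has a single
  element \<open>r\<close>, and \<open>r \<noteq> t\<close> because \<open>t\<close> does not absorb \<open>s\<close>; hence \<open>s \<boxplus> t \<boxplus> -t = r \<boxplus> -t\<close> is a
  single element too, and it can only be \<open>s\<close>.\<close>

lemma outside_ball_absorbs:
  assumes sS: "s \<in> S" and tS: "t \<in> S" and out: "s \<notin> ball t" and u: "u \<in> ball t"
  shows "h s u = {s}"
proof (cases "s = neg t")
  case True
  have uS: "u \<in> S" using u tS ball_closed by blast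
  have "u \<in> ball s" using u True ball_neg tS by simp
  then have "s \<in> h s u" using mem_ball_iff uS sS by blast
  moreover have "s \<noteq> neg u"
    using u out uS tS neg_mem_ball by blast
  ultimately show ?thesis using hadd_eq_singleton sS uS by blast
next
  case False
  have ntS: "neg t \<in> S" and uS: "u \<in> S" using tS neg_closed u ball_closed by blast+
  obtain r where r: "h s t = {r}"
    using stringent[OF sS tS False] by (auto simp: is_singleton_def)
  have rS: "r \<in> S" using r sS tS hadd_closed by blast
  have "r \<noteq> t" using r out mem_ball_iff[OF sS tS] hadd_comm[OF sS tS] by auto
  moreover have "s \<in> h r (neg t)" using move_right[of r s t] r sS tS by blast
  ultimately have "h r (neg t) = {s}"
    using hadd_eq_singleton[of s r "neg t"] rS ntS neg_neg[OF tS] by simp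
  moreover have "h s u \<subseteq> h r (neg t)"
  proof
    fix v assume "v \<in> h s u"
    then obtain r' where "r' \<in> h s t" "v \<in> h r' (neg t)"
      using hadd_assocE[OF _ u] sS tS ntS by blast
    then show "v \<in> h r (neg t)" using r by simp
  qed
  ultimately show ?thesis using hadd_nonempty[OF sS uS] by (metis subset_singletonD)
qed

lemma ball_subset:
  assumes "s \<in> S" "t \<in> S" "s \<notin> ball t"
  shows "ball t \<subseteq> ball s"
proof
  fix u assume u: "u \<in> ball t"
  then have "s \<in> h s u" using outside_ball_absorbs assms by blast
  then show "u \<in> ball s" using mem_ball_iff u ball_closed assms by blast
qed

lemma ball_hadd_closed:
  assumes "z \<in> h w s" "w \<in> ball t" "s \<in> ball t" "t \<in> S"
  shows "z \<in> ball t"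
proof (rule ccontr)
  assume "z \<notin> ball t"
  have S: "w \<in> S" "s \<in> S" "z \<in> S"
    using assms ball_closed mem_hadd_closed by blast+
  have "h z (neg w) = {z}"
    using outside_ball_absorbs \<open>z \<notin> ball t\<close> assms S neg_mem_ball by blast
  then have "s = z" using move_left[of z w s] assms S by blast
  then show False using \<open>z \<notin> ball t\<close> assms by blast
qed

text \<open>Two elements in each other's ball absorb each other; if their hypersum is a single element,
  it equals both.\<close>

lemma ball_antisym:
  assumes "s \<in> ball t" "t \<in> ball s" "s \<in> S" "t \<in> S"
  shows "s = t \<or> s = neg t"
proof -
  have "t \<in> h s t" "s \<in> h s t"
    using assms mem_ball_iff hadd_comm by blast+
  then show ?thesis using hadd_eq_singleton[of _ s t] assms by blast
qed

text \<open>An error from the ball of \<open>t\<close> leads out of a difference \<open>p \<boxplus> -q\<close> only if both terms lie in that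
  ball themselves. Otherwise, if \<open>p \<noteq> q\<close>, the difference lies outside the ball and absorbs
  the error, and if \<open>p = q\<close>, the difference is a ball that already contains the error and is closed
  under addition.\<close>

lemma terms_in_ball_of_error:
  assumes w: "w \<in> h p (neg q)" and s: "s \<in> ball t" and z: "z \<in> h w s"
    and nz: "z \<notin> h p (neg q)" and S: "p \<in> S" "q \<in> S" "t \<in> S"
  shows "p \<in> ball t" "q \<in> ball t"
proof -
  note N = neg_closed[OF S(1)] neg_closed[OF S(2)]
  have sS: "s \<in> S" and wS: "w \<in> S"
    using s w S N ball_closed mem_hadd_closed by blast+
  have wt: "w \<in> ball t"
    using outside_ball_absorbs[OF wS S(3) _ s] z w nz by (metis singletonD)
  have "p \<in> ball t \<and> q \<in> ball t"
  proof (cases "p = q")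
    case True
    have "q \<in> ball t"
    proof (rule ccontr)
      assume "q \<notin> ball t"
      then have "s \<in> ball q" using ball_subset s S by blast
      then show False using ball_hadd_closed z w nz True S by blast
    qed
    then show ?thesis using True by simp
  next
    case False
    have q: "neg q \<in> h (neg p) w" "p \<in> h q w"
      using move_left[OF w] move_right[OF w] S N wS hadd_comm neg_neg by auto
    have "neg p \<in> ball t"
    proof (rule ccontr)
      assume "neg p \<notin> ball t"
      then have "neg q = neg p" using outside_ball_absorbs[OF N(1) S(3) _ wt] q by (metis singletonD)
      then show False using False neg_neg S by metis
    qed
    moreover have "q \<in> ball t"
      using outside_ball_absorbs[OF S(2,3) _ wt] q False by (metis singletonD)
    ultimately show ?thesis using neg_mem_ball_iff S by blast
  qed
  then show "p \<in> ball t" "q \<in> ball t" by blast+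
qed

end

section \<open>Signs and balls in a skew hyperfield\<close>

context skew_hyperfield
begin

sublocale H: hypergroup "carrier F" "hadd F" "hzero F" by (rule hypergroup)
sublocale G: group "mult_group F" by (rule mult_group)

lemma hminus_eq: "\<boxminus> x = H.neg x"
  by (simp add: hminus_def)

lemma nonzero_mult:
  "\<lbrakk>x \<in> carrier F - {hzero F}; y \<in> carrier F - {hzero F}\<rbrakk> \<Longrightarrow> x \<otimes> y \<in> carrier F - {hzero F}"
  using G.m_closed[of x y] by simp

lemma one_nonzero: "\<one> \<in> carrier F - {hzero F}"
  using one_closed zero_not_one by simp

lemma one_mult: "x \<in> carrier F \<Longrightarrow> \<one> \<otimes> x = x"
  using G.l_one[of x] mult_zero[OF one_closed] by (cases "x = hzero F") auto

lemma mult_one: "x \<in> carrier F \<Longrightarrow> x \<otimes> \<one> = x"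
  using G.r_one[of x] zero_mult[OF one_closed] by (cases "x = hzero F") auto

lemma mult_mem_hadd:
  "\<lbrakk>z \<in> x \<boxplus> y; a \<in> carrier F; x \<in> carrier F; y \<in> carrier F\<rbrakk> \<Longrightarrow> a \<otimes> z \<in> (a \<otimes> x) \<boxplus> (a \<otimes> y)"
  "\<lbrakk>z \<in> x \<boxplus> y; a \<in> carrier F; x \<in> carrier F; y \<in> carrier F\<rbrakk> \<Longrightarrow> z \<otimes> a \<in> (x \<otimes> a) \<boxplus> (y \<otimes> a)"
  using distrib_left[of a x y] distrib_right[of a x y] by blast+

lemma hminus_nonzero: "x \<in> carrier F - {hzero F} \<Longrightarrow> \<boxminus> x \<in> carrier F - {hzero F}"
  unfolding hminus_eq
  using H.neg_closed H.zero_in_hadd_neg hadd_zero_right by (metis DiffD1 DiffD2 DiffI singletonD singletonI)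

lemma mult_hminus: "\<lbrakk>a \<in> carrier F; x \<in> carrier F\<rbrakk> \<Longrightarrow> a \<otimes> \<boxminus> x = \<boxminus> (a \<otimes> x)"
  unfolding hminus_eq
  using mult_mem_hadd(1)[OF H.zero_in_hadd_neg, of x a] H.neg_unique mult_closed H.neg_closed mult_zero
  by metis

lemma hminus_mult: "\<lbrakk>a \<in> carrier F; x \<in> carrier F\<rbrakk> \<Longrightarrow> (\<boxminus> x) \<otimes> a = \<boxminus> (x \<otimes> a)"
  unfolding hminus_eq
  using mult_mem_hadd(2)[OF H.zero_in_hadd_neg, of x a] H.neg_unique mult_closed H.neg_closed zero_mult
  by metis

lemma mult_left_cancel:
  "\<lbrakk>a \<in> carrier F - {hzero F}; u \<in> carrier F; v \<in> carrier F; a \<otimes> u = a \<otimes> v\<rbrakk> \<Longrightarrow> u = v"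
  using G.Units_l_cancel[of a u v] G.Units_eq nonzero_mult[of a u] nonzero_mult[of a v] mult_zero[of a]
  by (cases "u = hzero F"; cases "v = hzero F") auto

lemma mult_right_cancel:
  "\<lbrakk>a \<in> carrier F - {hzero F}; u \<in> carrier F; v \<in> carrier F; u \<otimes> a = v \<otimes> a\<rbrakk> \<Longrightarrow> u = v"
  using G.right_cancel[of a u v] nonzero_mult[of u a] nonzero_mult[of v a] zero_mult[of a]
  by (cases "u = hzero F"; cases "v = hzero F") auto

lemma mult_mem_ball_iff:
  assumes a: "a \<in> carrier F - {hzero F}" and "s \<in> carrier F" "t \<in> carrier F"
  shows "a \<otimes> s \<in> H.ball (a \<otimes> t) \<longleftrightarrow> s \<in> H.ball t"
proof -
  have "H.ball (a \<otimes> t) = (\<lambda>u. a \<otimes> u) ` H.ball t"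
    using distrib_left[of a t "H.neg t"] mult_hminus[of a t] assms H.neg_closed
    by (simp add: hminus_eq)
  then show ?thesis using mult_left_cancel[OF a] H.ball_closed assms by (auto, blast)
qed

lemma mem_ball_mult_iff:
  assumes a: "a \<in> carrier F - {hzero F}" and "s \<in> carrier F" "t \<in> carrier F"
  shows "s \<otimes> a \<in> H.ball (t \<otimes> a) \<longleftrightarrow> s \<in> H.ball t"
proof -
  have "H.ball (t \<otimes> a) = (\<lambda>u. u \<otimes> a) ` H.ball t"
    using distrib_right[of a t "H.neg t"] hminus_mult[of a t] assms H.neg_closed
    by (simp add: hminus_eq)
  then show ?thesis using mult_right_cancel[OF a] H.ball_closed assms by (auto, blast)
qed

end

section \<open>Cancellation in a stringent skew hyperfield\<close>

context stringent_skew_hyperfield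
begin

sublocale H: stringent_hypergroup "carrier F" "hadd F" "hzero F"
  by unfold_locales (use stringent hminus_eq in auto)

text \<open>Both \<open>ab\<close> and \<open>xy\<close> can be inserted and removed again: formally,
  \<open>xb - ay = (xb - ab) + (ab - ay) = b + a\<close> and \<open>xb - ay = (xb - xy) + (xy - ay) = x + y\<close>.
  So \<open>z\<close> differs from \<open>xb - ay\<close> by an error in the ball of \<open>ab\<close> and also by one in the ball
  of \<open>xy\<close>. If \<open>z\<close> is not a value of \<open>xb - ay\<close>, then \<open>xb\<close> and \<open>ay\<close> are in both balls, and cancelling
  common factors puts \<open>x\<close> and \<open>a\<close> in each other's ball, and likewise \<open>y\<close> and \<open>b\<close>. This
  leaves four combinations of signs to be checked.\<close>

theorem sum_mem_cross_difference:
  assumes a0: "a \<in> carrier F - {hzero F}" and b0: "b \<in> carrier F - {hzero F}"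
    and x0: "x \<in> carrier F - {hzero F}" and y0: "y \<in> carrier F - {hzero F}"
    and x: "x \<in> \<one> \<boxplus> a" and y: "y \<in> (\<boxminus> \<one>) \<boxplus> b"
    and zab: "z \<in> a \<boxplus> b" and zxy: "z \<in> x \<boxplus> y"
  shows "z \<in> (x \<otimes> b) \<boxplus> (\<boxminus> (a \<otimes> y))"
proof (rule ccontr)
  assume nz: "z \<notin> (x \<otimes> b) \<boxplus> (\<boxminus> (a \<otimes> y))"
  have C: "a \<in> carrier F" "b \<in> carrier F" "x \<in> carrier F" "y \<in> carrier F"
    using a0 b0 x0 y0 by auto
  note P = mult_closed[OF C(1,2)] mult_closed[OF C(3,2)] mult_closed[OF C(1,4)]
    mult_closed[OF C(3,4)]
  note N = H.neg_closed[OF C(1)] H.neg_closed[OF C(2)] H.neg_closed[OF C(3)]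
    H.neg_closed[OF C(4)] H.neg_closed[OF one_closed]
  note PN = H.neg_closed[OF P(1)] H.neg_closed[OF P(2)] H.neg_closed[OF P(3)] H.neg_closed[OF P(4)]
  have y': "y \<in> H.neg \<one> \<boxplus> b" using y by (simp add: hminus_eq)
  have nz': "z \<notin> (x \<otimes> b) \<boxplus> H.neg (a \<otimes> y)" using nz by (simp add: hminus_eq)

  \<comment> \<open>The two ways of writing \<open>z\<close> as a cross difference up to an error.\<close>
  have "a \<otimes> y \<in> H.neg a \<boxplus> (a \<otimes> b)"
    using mult_mem_hadd(1)[OF y' C(1) N(5) C(2)] mult_hminus[OF C(1) one_closed] C
    by (simp add: hminus_eq mult_one)
  then have "H.neg a \<in> (a \<otimes> y) \<boxplus> H.neg (a \<otimes> b)" using H.move_right N P by blast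
  then have ea: "a \<in> H.neg (a \<otimes> y) \<boxplus> (a \<otimes> b)"
    using H.neg_hadd[of "H.neg a"] N P PN C H.neg_neg by metis
  have "x \<otimes> b \<in> b \<boxplus> (a \<otimes> b)"
    using mult_mem_hadd(2)[OF x C(2) one_closed C(1)] C by (simp add: one_mult)
  then have eb: "b \<in> (x \<otimes> b) \<boxplus> H.neg (a \<otimes> b)" using H.move_right C P by blast
  obtain w s where ws: "w \<in> (x \<otimes> b) \<boxplus> H.neg (a \<otimes> y)" "s \<in> H.ball (a \<otimes> b)" "z \<in> w \<boxplus> s"
    using H.sum_of_differences[OF zab ea eb P(2,3,1)] by blast

  have "b \<in> y \<boxplus> \<one>"
    using H.move_left[OF y'] N C one_closed H.neg_neg by simp
  then have "x \<otimes> b \<in> (x \<otimes> y) \<boxplus> x"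
    using mult_mem_hadd(1)[of b y "\<one>" x] C one_closed by (simp add: mult_one)
  then have ex: "x \<in> (x \<otimes> b) \<boxplus> H.neg (x \<otimes> y)" using H.move_left C P by blast
  have "x \<otimes> y \<in> y \<boxplus> (a \<otimes> y)"
    using mult_mem_hadd(2)[OF x C(4) one_closed C(1)] C by (simp add: one_mult)
  then have ey: "y \<in> H.neg (a \<otimes> y) \<boxplus> (x \<otimes> y)"
    using H.move_right[of "x \<otimes> y" y "a \<otimes> y"] H.hadd_comm C P PN by auto
  have zyx: "z \<in> y \<boxplus> x" using zxy H.hadd_comm C by blast
  obtain w' s' where ws': "w' \<in> (x \<otimes> b) \<boxplus> H.neg (a \<otimes> y)" "s' \<in> H.ball (x \<otimes> y)" "z \<in> w' \<boxplus> s'"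
    using H.sum_of_differences[OF zyx ey ex P(2,3,4)] by blast

  have "x \<in> H.ball a" "y \<in> H.ball b"
    using H.terms_in_ball_of_error[OF ws nz' P(2,3,1)] mult_mem_ball_iff[OF a0]
      mem_ball_mult_iff[OF b0] C by blast+
  moreover have bally: "b \<in> H.ball y" and ballx: "a \<in> H.ball x"
    using H.terms_in_ball_of_error[OF ws' nz' P(2,3,4)] mult_mem_ball_iff[OF x0]
      mem_ball_mult_iff[OF y0] C by blast+
  ultimately have xa: "x = a \<or> x = H.neg a" and yb: "y = b \<or> y = H.neg b"
    using H.ball_antisym C by blast+

  have "a \<in> H.ball a" "b \<in> H.ball b"
    using xa yb ballx bally H.ball_neg C by metis+
  then have aa: "a \<in> a \<boxplus> a" and bb: "b \<in> b \<boxplus> b"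
    using H.mem_ball_iff C by blast+

  have "H.neg a \<otimes> b = H.neg (a \<otimes> b)" "a \<otimes> H.neg b = H.neg (a \<otimes> b)"
    using mult_hminus[OF C(1,2)] hminus_mult[OF C(2,1)] by (simp_all only: hminus_eq)
  then have prod_ab: "(x \<otimes> b) \<boxplus> H.neg (a \<otimes> y) = H.ball (a \<otimes> b)"
    if "x = a \<and> y = b \<or> x = H.neg a \<and> y = H.neg b"
    using that H.ball_neg[OF P(1)] by metis

  \<comment> \<open>With equal signs, \<open>xb\<close> and \<open>ay\<close> cancel, leaving a ball that contains the error term.\<close>
  have "\<not> (x = a \<and> y = b \<or> x = H.neg a \<and> y = H.neg b)"
    using H.ball_hadd_closed[OF ws(3) _ ws(2) P(1)] ws(1) nz' prod_ab by blast
  then consider "x = H.neg a" "y = b" "a \<noteq> H.neg a" | "x = a" "y = H.neg b" "b \<noteq> H.neg b"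
    using xa yb by metis
  then show False
  proof cases
    case 1
    \<comment> \<open>Here \<open>-a\<close> is a value of \<open>1 + a\<close>, so \<open>1\<close> is one of \<open>-a - a\<close>, whose only value is \<open>-a\<close>.
      Hence \<open>x = 1\<close> and \<open>a = -1\<close>, and \<open>z = b\<close> is a value of \<open>b + b\<close>.\<close>
    have "\<one> \<in> H.neg a \<boxplus> H.neg a"
      using H.move_right[OF x] 1(1) C one_closed by simp
    moreover have "H.neg a \<boxplus> H.neg a = {H.neg a}"
      using H.hadd_eq_singleton[OF H.neg_hadd[OF aa C(1) C(1)]] 1(3) C N H.neg_neg by auto
    ultimately have x1: "x = \<one>" and a1: "a = H.neg \<one>"
      using 1(1) C H.neg_neg by auto
    have goal: "(x \<otimes> b) \<boxplus> H.neg (a \<otimes> y) = b \<boxplus> b"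
      using x1 a1 1(2) one_mult C H.neg_neg hminus_mult[OF C(2) one_closed] by (simp add: hminus_eq)
    show False
    proof (cases "b = \<one>")
      case True
      then show False using zxy x1 1(2) True goal nz' by simp
    next
      case False
      then have "H.neg \<one> \<noteq> H.neg b" using H.neg_neg C one_closed by metis
      then have "H.neg \<one> \<boxplus> b = {b}" using H.hadd_eq_singleton[OF y'] N C 1 by simp
      then show False using zab a1 goal bb nz' by simp
    qed
  next
    case 2
    \<comment> \<open>The mirror image: \<open>-b\<close> is a value of \<open>-1 + b\<close>, which forces \<open>b = 1\<close> and \<open>y = -1\<close>.\<close>
    have "H.neg \<one> \<in> H.neg b \<boxplus> H.neg b"
      using H.move_right[OF y'] 2(2) C N by simp
    moreover have "H.neg b \<boxplus> H.neg b = {H.neg b}"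
      using H.hadd_eq_singleton[OF H.neg_hadd[OF bb C(2) C(2)]] 2(3) C N H.neg_neg by auto
    ultimately have y1: "y = H.neg \<one>" and b1: "b = \<one>"
      using 2(2) C H.neg_neg one_closed by (auto, metis)
    have goal: "(x \<otimes> b) \<boxplus> H.neg (a \<otimes> y) = a \<boxplus> a"
      using y1 b1 2(1) mult_one C H.neg_neg mult_hminus[OF C(1) one_closed] by (simp add: hminus_eq)
    show False
    proof (cases "a = H.neg \<one>")
      case True
      then show False using zxy y1 2(1) True goal nz' by simp
    next
      case False
      then have "\<one> \<boxplus> a = {a}"
        using H.hadd_eq_singleton[OF x] C one_closed 2 H.neg_neg by metis
      then show False using zab b1 goal aa nz' H.hadd_comm C one_closed by auto
    qed
  qed
qed

end

section \<open>Null sums of three terms\<close>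

context skew_hyperfield
begin

lemma hsum_swap:
  assumes "u \<in> carrier F" "v \<in> carrier F" "set gs \<subseteq> carrier F"
  shows "hsum F (u # v # gs) = hsum F (v # u # gs)"
proof -
  have "(\<Union>s\<in>v \<boxplus> t. u \<boxplus> s) = (\<Union>s\<in>u \<boxplus> t. v \<boxplus> s)" if "t \<in> carrier F" for t
    using H.hadd_assoc[of u v t] H.hadd_assoc[of v u t] H.hadd_comm[of u v] assms that
    by (simp add: set_hadd_def)
  then show ?thesis using hsum_closed[OF assms(3)] by (simp add: subset_iff)
qed

lemma hsum_insert_middle:
  "\<lbrakk>u \<in> carrier F; set (gs @ hs) \<subseteq> carrier F\<rbrakk> \<Longrightarrow> hsum F (gs @ u # hs) = hsum F (u # gs @ hs)"
proof (induction gs)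
  case (Cons g gs)
  then have "hsum F ((g # gs) @ u # hs) = hsum F (g # u # gs @ hs)" by simp
  also have "\<dots> = hsum F (u # g # gs @ hs)" using Cons.prems by (intro hsum_swap) auto
  finally show ?case by simp
qed simp

text \<open>Null sums are multisets, whereas hypersums are bracketed along a list; this identifies
  membership in the null set with a hypersum in any convenient order.\<close>

lemma hsum_permute:
  "\<lbrakk>mset gs = mset hs; set gs \<subseteq> carrier F\<rbrakk> \<Longrightarrow> hsum F gs = hsum F hs"
proof (induction gs arbitrary: hs)
  case (Cons g gs)
  then have "g \<in> set hs" using mset_eq_setD by fastforce
  then obtain hs1 hs2 where hs: "hs = hs1 @ g # hs2" using split_list by metis
  then have m: "mset gs = mset (hs1 @ hs2)" using Cons.prems by simp
  have "set (hs1 @ hs2) \<subseteq> carrier F" using mset_eq_setD[OF m] Cons.prems by auto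
  then have "hsum F hs = hsum F (g # hs1 @ hs2)"
    unfolding hs using Cons.prems by (intro hsum_insert_middle) auto
  then show ?case using Cons.IH[OF m] Cons.prems by simp
qed simp

lemma mset_null_iff:
  assumes "set gs \<subseteq> carrier F - {hzero F}"
  shows "mset gs \<in> nullset (tract_of F) \<longleftrightarrow> hzero F \<in> hsum F gs"
proof
  assume "mset gs \<in> nullset (tract_of F)"
  then obtain hs where "mset gs = mset hs" "hzero F \<in> hsum F hs" by auto
  then show "hzero F \<in> hsum F gs" using hsum_permute[of gs hs] assms by auto
next
  assume "hzero F \<in> hsum F gs"
  then show "mset gs \<in> nullset (tract_of F)" using assms by auto
qed

text \<open>With \<open>-w\<close> put first, the sum is null exactly if \<open>u \<boxplus> v\<close> contains the unique negative of \<open>-w\<close>,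
  which is \<open>w\<close>.\<close>

lemma triple_null_iff:
  assumes u: "u \<in> carrier F - {hzero F}" and v: "v \<in> carrier F - {hzero F}"
    and w: "w \<in> carrier F - {hzero F}"
  shows "{#u, v, \<boxminus> w#} \<in> nullset (tract_of F) \<longleftrightarrow> w \<in> u \<boxplus> v"
proof -
  have n: "\<boxminus> w \<in> carrier F - {hzero F}" using hminus_nonzero[OF w] .
  have "{#u, v, \<boxminus> w#} = mset [\<boxminus> w, u, v]" by simp
  then have "{#u, v, \<boxminus> w#} \<in> nullset (tract_of F) \<longleftrightarrow> hzero F \<in> hsum F [\<boxminus> w, u, v]"
    using mset_null_iff[of "[\<boxminus> w, u, v]"] u v n by (metis empty_set empty_subsetI insert_subset list.simps(15))
  also have "\<dots> \<longleftrightarrow> (\<exists>s\<in>u \<boxplus> v. hzero F \<in> (\<boxminus> w) \<boxplus> s)"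
    using v by (simp add: hadd_zero_right)
  also have "\<dots> \<longleftrightarrow> w \<in> u \<boxplus> v"
  proof
    assume "\<exists>s\<in>u \<boxplus> v. hzero F \<in> (\<boxminus> w) \<boxplus> s"
    then obtain s where s: "s \<in> u \<boxplus> v" "hzero F \<in> (\<boxminus> w) \<boxplus> s" by blast
    then have "s \<in> carrier F" using u v H.mem_hadd_closed by blast
    then have "s = w" using H.neg_unique[of "\<boxminus> w" s] s n w H.neg_neg[of w] by (simp add: hminus_eq)
    then show "w \<in> u \<boxplus> v" using s by simp
  next
    assume "w \<in> u \<boxplus> v"
    moreover have "hzero F \<in> (\<boxminus> w) \<boxplus> w"
      using H.zero_in_hadd_neg[of w] H.hadd_comm[of w "\<boxminus> w"] w n by (simp add: hminus_eq)
    ultimately show "\<exists>s\<in>u \<boxplus> v. hzero F \<in> (\<boxminus> w) \<boxplus> s" by blast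
  qed
  finally show ?thesis .
qed

lemma tract_neg_one_eq: "tract_neg_one (tract_of F) = \<boxminus> \<one>"
  unfolding tract_neg_one_def
proof (rule the_equality)
  have n: "\<boxminus> \<one> \<in> carrier F - {hzero F}" using hminus_nonzero[OF one_nonzero] .
  then show "\<boxminus> \<one> \<in> carrier (tract_of F) \<and> {#\<one>\<^bsub>tract_of F\<^esub>, \<boxminus> \<one>#} \<in> nullset (tract_of F)"
    using pair_null_iff[OF one_nonzero n] H.zero_in_hadd_neg[OF one_closed]
    by (simp add: hminus_eq del: tract_of_simps(4))
  fix u assume "u \<in> carrier (tract_of F) \<and> {#\<one>\<^bsub>tract_of F\<^esub>, u#} \<in> nullset (tract_of F)"
  then have "u \<in> carrier F - {hzero F}" "hzero F \<in> \<one> \<boxplus> u"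
    using pair_null_iff[OF one_nonzero, of u] by (auto simp del: tract_of_simps(4))
  then show "u = \<boxminus> \<one>" using H.neg_unique one_closed by (simp add: hminus_eq)
qed

lemma tract_neg_eq: "x \<in> carrier F \<Longrightarrow> tract_neg (tract_of F) x = \<boxminus> x"
  using hminus_mult[of x "\<one>"] one_closed one_mult by (simp add: tract_neg_def tract_neg_one_eq)

end

lemma (in stringent_skew_hyperfield) pathetic_cancellation_tract_of:
  "pathetic_cancellation (tract_of F)"
  unfolding pathetic_cancellation_def tract_neg_one_eq tract_of_simps(1-3)
proof (intro ballI impI)
  fix a b x y z
  assume nonzero: "a \<in> carrier F - {hzero F}" "b \<in> carrier F - {hzero F}"
    "x \<in> carrier F - {hzero F}" "y \<in> carrier F - {hzero F}" "z \<in> carrier F - {hzero F}"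
    and null: "{#\<one>, a, tract_neg (tract_of F) x#} \<in> nullset (tract_of F)"
    "{#\<boxminus> \<one>, b, tract_neg (tract_of F) y#} \<in> nullset (tract_of F)"
    "{#a, b, tract_neg (tract_of F) z#} \<in> nullset (tract_of F)"
    "{#x, y, tract_neg (tract_of F) z#} \<in> nullset (tract_of F)"
  note neg_eq = tract_neg_eq[OF DiffD1]
  note prods = nonzero_mult[OF nonzero(3,2)] nonzero_mult[OF nonzero(1,4)]
  have "x \<in> \<one> \<boxplus> a" "y \<in> (\<boxminus> \<one>) \<boxplus> b" "z \<in> a \<boxplus> b" "z \<in> x \<boxplus> y"
    using null nonzero one_nonzero hminus_nonzero[OF one_nonzero]
    by (simp_all only: neg_eq triple_null_iff)
  then have "z \<in> (x \<otimes> b) \<boxplus> (\<boxminus> (a \<otimes> y))"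
    using sum_mem_cross_difference nonzero by blast
  then show "{#x \<otimes> b, tract_neg (tract_of F) (a \<otimes> y), tract_neg (tract_of F) z#}
      \<in> nullset (tract_of F)"
    using nonzero prods hminus_nonzero[OF prods(2)] by (simp only: neg_eq triple_null_iff)
qed

theorem theorem1p9:
  fixes F :: "('a, 'm) hyperring_scheme" (structure)
  assumes "stringent_skew_hyperfield F"
  shows "pathetic_cancellation (tract_of F) \<and>
    (\<forall>a\<in>carrier (mult_group F). \<forall>b\<in>carrier (mult_group F). \<forall>x\<in>carrier (mult_group F).
     \<forall>y\<in>carrier (mult_group F). \<forall>z\<in>carrier (mult_group F).
      x \<in> \<one> \<boxplus> a \<longrightarrow> y \<in> (\<boxminus> \<one>) \<boxplus> b \<longrightarrow> z \<in> a \<boxplus> b \<longrightarrow> z \<in> x \<boxplus> y \<longrightarrow>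
      a \<otimes> x = x \<otimes> a \<longrightarrow> b \<otimes> y = y \<otimes> b \<longrightarrow>
      inv\<^bsub>mult_group F\<^esub> a \<otimes> z \<otimes> inv\<^bsub>mult_group F\<^esub> b
        = inv\<^bsub>mult_group F\<^esub> b \<otimes> z \<otimes> inv\<^bsub>mult_group F\<^esub> a \<longrightarrow>
      inv\<^bsub>mult_group F\<^esub> x \<otimes> z \<otimes> inv\<^bsub>mult_group F\<^esub> y
        = inv\<^bsub>mult_group F\<^esub> y \<otimes> z \<otimes> inv\<^bsub>mult_group F\<^esub> x \<longrightarrow>
      z \<in> (x \<otimes> b) \<boxplus> (\<boxminus> (a \<otimes> y)))"
proof (intro conjI ballI impI)
  interpret stringent_skew_hyperfield F by fact
  show "pathetic_cancellation (tract_of F)" by (rule pathetic_cancellation_tract_of)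
  fix a b x y z
  assume "a \<in> carrier (mult_group F)" "b \<in> carrier (mult_group F)"
    "x \<in> carrier (mult_group F)" "y \<in> carrier (mult_group F)"
    "x \<in> \<one> \<boxplus> a" "y \<in> (\<boxminus> \<one>) \<boxplus> b" "z \<in> a \<boxplus> b" "z \<in> x \<boxplus> y"
  then show "z \<in> (x \<otimes> b) \<boxplus> (\<boxminus> (a \<otimes> y))"
    using sum_mem_cross_difference by simp
qed

end
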